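(* (Strong duality) Consider the gauge optimization problem (P) and its dual (D) defined in the context. Suppose that all elements of $d$ and $K$ are nonnegative and that the Slater constraint qualification holds for (P). If (P) has an optimal solution $x^*$, then (D) also has an optimal solution $(u^*,v^* )$ and the duality gap between (P) and (D) is zero, that is, $c^Tx^*+d^T\mathcal{G}(x^* )=b^Tu^*-p^Tv^*$.
   Context: Vector inequalities are componentwise. The index set $\{1,\dots,n\}$ is partitioned into pairwise disjoint sets $I_1,\dots,I_m$ with $\#I_i=n_i$, $n=n_1+\cdots+n_m$; $x_{I_i}\in\mathbb{R}^{n_i}$ is the corresponding subvector of $x\in\mathbb{R}^n$. A gauge function is a function $g:\mathbb{R}^q\to\mathbb{R}\cup\{\infty\}$ that is convex, nonnegative, positively homogeneous ($g(\lambda x)=\lambda g(x)$ for all $x$ and $\lambda>0$) and satisfies $g(0)=0$. A vector gauge function is $\mathcal{G}(x)=(g_1(x_{I_1}),\dots,g_m(x_{I_m}))^T$ with each $g_i:\mathbb{R}^{n_i}\to\mathbb{R}\cup\{\infty\}$ a gauge function; $\mathrm{dom}\,\mathcal{G}=\{x : g_i(x_{I_i})<\infty,\ i=1,\dots,m\}$. The polar of $g_i$ is $g_i^\circ(y)=\sup\{x^Ty : g_i(x)\le 1\}$, and $\mathcal{G}^\circ(y)=(g_1^\circ(y_{I_1}),\dots,g_m^\circ(y_{I_m}))^T$. Given $c\in\mathbb{R}^n$, $d\in\mathbb{R}^m$, $b\in\mathbb{R}^k$, $p\in\mathbb{R}^\ell$, $A\in\mathbb{R}^{k\times n}$, $H\in\mathbb{R}^{\ell\times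 n}$, $K\in\mathbb{R}^{\ell\times m}$ and a vector gauge function $\mathcal{G}$: (P): minimize $c^Tx+d^T\mathcal{G}(x)$ subject to $Ax=b$, $Hx+K\mathcal{G}(x)\le p$, $x\in\mathrm{dom}\,\mathcal{G}$. (D): maximize $b^Tu-p^Tv$ over $(u,v)\in\mathbb{R}^k\times\mathbb{R}^\ell$ subject to $\mathcal{G}^\circ(A^Tu-H^Tv-c)-K^Tv\le d$, $v\ge 0$. Slater constraint qualification for (P): there exists $\hat x$ in the relative interior of $\mathrm{dom}\,\mathcal{G}$ with $A\hat x=b$ and $H\hat x+K\mathcal{G}(\hat x)<p$ (strictly in every component). *)

theory Defs
  imports "HOL-Analysis.Analysis"
begin

text \<open>
  The space of subvectors \<open>x\<^sub>J\<close>, for a set \<open>J\<close> of indices, is represented by the coordinate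
  subspace of vectors vanishing outside \<open>J\<close>; taking a subvector is then zeroing the other
  coordinates. This representation preserves linear structure and inner products, so gauge
  functions are defined relative to a linear subspace \<open>S\<close>; their values outside \<open>S\<close> are never used.
\<close>

definition coord_space :: "'n::finite set \<Rightarrow> (real^'n) set" where
  "coord_space J = {x. \<forall>j. j \<notin> J \<longrightarrow> x $ j = 0}"

definition subvec :: "'n::finite set \<Rightarrow> real^'n \<Rightarrow> real^'n" where
  "subvec J x = (\<chi> j. if j \<in> J then x $ j else 0)"

text \<open>
  Nonnegativity excludes \<open>-\<infinity>\<close>. The weights in the convexity inequality are positive, so no
  product \<open>0 * \<infinity>\<close> arises.
\<close>

definition gauge_fun_on :: "'a::real_vector set \<Rightarrow> ('a \<Rightarrow> ereal) \<Rightarrow> bool" where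
  "gauge_fun_on S g \<longleftrightarrow>
     (\<forall>x\<in>S. \<forall>y\<in>S. \<forall>t::real. 0 < t \<and> t < 1 \<longrightarrow>
        g ((1 - t) *\<^sub>R x + t *\<^sub>R y) \<le> ereal (1 - t) * g x + ereal t * g y) \<and>
     (\<forall>x\<in>S. 0 \<le> g x) \<and>
     (\<forall>x\<in>S. \<forall>t::real. 0 < t \<longrightarrow> g (t *\<^sub>R x) = ereal t * g x) \<and>
     g 0 = 0"

definition polar_on :: "'a::real_inner set \<Rightarrow> ('a \<Rightarrow> ereal) \<Rightarrow> 'a \<Rightarrow> ereal" where
  "polar_on S g y = (SUP x\<in>{x \<in> S. g x \<le> 1}. ereal (x \<bullet> y))"

definition vgauge :: "('m::finite \<Rightarrow> 'n::finite set) \<Rightarrow> ('m::finite \<Rightarrow> real^'n \<Rightarrow> ereal) \<Rightarrow> real^'n \<Rightarrow> ereal^'m" where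
  "vgauge I g x = (\<chi> i. g i (subvec (I i) x))"

definition vgauge_dom :: "('m::finite \<Rightarrow> 'n::finite set) \<Rightarrow> ('m::finite \<Rightarrow> real^'n \<Rightarrow> ereal) \<Rightarrow> (real^'n) set" where
  "vgauge_dom I g = {x. \<forall>i. vgauge I g x $ i < \<infinity>}"

definition vgauge_polar :: "('m::finite \<Rightarrow> 'n::finite set) \<Rightarrow> ('m::finite \<Rightarrow> real^'n \<Rightarrow> ereal) \<Rightarrow> real^'n \<Rightarrow> ereal^'m" where
  "vgauge_polar I g y = (\<chi> i. polar_on (coord_space (I i)) (g i) (subvec (I i) y))"

text \<open>
  The finite values of the vector gauge as a real vector; meaningful only on its domain, which is
  part of the feasibility conditions below.
\<close>

definition vgauge_real :: "('m::finite \<Rightarrow> 'n::finite set) \<Rightarrow> ('m::finite \<Rightarrow> real^'n \<Rightarrow> ereal) \<Rightarrow> real^'n \<Rightarrow> real^'m" where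
  "vgauge_real I g x = (\<chi> i. real_of_ereal (vgauge I g x $ i))"

definition primal_obj ::
  "real^'n \<Rightarrow> real^'m \<Rightarrow> ('m::finite \<Rightarrow> 'n::finite set) \<Rightarrow> ('m::finite \<Rightarrow> real^'n \<Rightarrow> ereal) \<Rightarrow> real^'n \<Rightarrow> real" where
  "primal_obj c d I g x = c \<bullet> x + d \<bullet> vgauge_real I g x"

definition primal_feasible ::
  "real^'n^'k \<Rightarrow> real^'k \<Rightarrow> real^'n^'l \<Rightarrow> real^'m^'l \<Rightarrow> real^'l \<Rightarrow>
   ('m::finite \<Rightarrow> 'n::finite set) \<Rightarrow> ('m::finite \<Rightarrow> real^'n \<Rightarrow> ereal) \<Rightarrow> real^'n \<Rightarrow> bool" where
  "primal_feasible A b H K p I g x \<longleftrightarrow>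
     A *v x = b \<and> H *v x + K *v vgauge_real I g x \<le> p \<and> x \<in> vgauge_dom I g"

definition dual_obj :: "real^'k \<Rightarrow> real^'l \<Rightarrow> (real^'k) \<times> (real^'l) \<Rightarrow> real" where
  "dual_obj b p = (\<lambda>(u, v). b \<bullet> u - p \<bullet> v)"

text \<open>The polar may be infinite, so the dual inequality is one between extended reals.\<close>

definition dual_feasible ::
  "real^'n \<Rightarrow> real^'m \<Rightarrow> real^'n^'k \<Rightarrow> real^'n^'l \<Rightarrow> real^'m^'l \<Rightarrow>
   ('m::finite \<Rightarrow> 'n::finite set) \<Rightarrow> ('m::finite \<Rightarrow> real^'n \<Rightarrow> ereal) \<Rightarrow> (real^'k) \<times> (real^'l) \<Rightarrow> bool" where
  "dual_feasible c d A H K I g = (\<lambda>(u, v).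
     (\<forall>i. vgauge_polar I g (transpose A *v u - transpose H *v v - c) $ i
            - ereal ((transpose K *v v) $ i) \<le> ereal (d $ i)) \<and>
     0 \<le> v)"

text \<open>
  The strict inequality is spelled out because \<open><\<close> on vectors is the strict part of the
  componentwise order, not strictness in every component.
\<close>

definition slater ::
  "real^'n^'k \<Rightarrow> real^'k \<Rightarrow> real^'n^'l \<Rightarrow> real^'m^'l \<Rightarrow> real^'l \<Rightarrow>
   ('m::finite \<Rightarrow> 'n::finite set) \<Rightarrow> ('m::finite \<Rightarrow> real^'n \<Rightarrow> ereal) \<Rightarrow> bool" where
  "slater A b H K p I g \<longleftrightarrow>
     (\<exists>x \<in> rel_interior (vgauge_dom I g).
        A *v x = b \<and> (\<forall>j. (H *v x + K *v vgauge_real I g x) $ j < p $ j))"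

end

theory Submission
  imports Defs
begin

text \<open>
  Since \<open>d\<close> and \<open>K\<close> are nonnegative, the problem is convex, and the Slater point yields Lagrange
  multipliers: the Lagrangian is bounded below on the domain of the gauge by the optimal value.
  Up to a constant, the Lagrangian is positively homogeneous, so the bound at the origin says
  that the dual value is at least the optimal one, while letting the argument tend to infinity
  along rays gives \<open>w \<bullet> x \<le> e \<bullet> G x\<close> on the domain, which blockwise is the polar inequality
  of dual feasibility.
\<close>

section \<open>Lagrange multipliers for convex problems\<close>

text \<open>A negative slope is refuted at \<open>t = (\<bar>k\<bar> + 1) / (- m)\<close>, where the
  value is \<open>k - \<bar>k\<bar> - 1\<close>. This replaces the limits of large \<open>t\<close>
  below: for the signs of the multipliers, the polar inequality and dual feasibility.\<close>

lemma slope_nonneg: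
  fixes m k :: real
  assumes "\<And>t. t > 0 \<Longrightarrow> 0 \<le> m * t + k"
  shows "0 \<le> m"
proof (rule ccontr)
  assume "\<not> 0 \<le> m"
  then have "m * ((\<bar>k\<bar> + 1) / (- m)) = - (\<bar>k\<bar> + 1)" "(\<bar>k\<bar> + 1) / (- m) > 0"
    by (auto simp: field_simps divide_neg_neg add_pos_nonneg)
  with assms[of "(\<bar>k\<bar> + 1) / (- m)"] show False by linarith
qed

text \<open>The segment from \<open>x\<close> to \<open>z\<close> can be prolonged beyond
  \<open>z\<close> inside \<open>C\<close>; if \<open>\<phi> x\<close> were positive,
  \<open>\<phi>\<close> would be negative there.\<close>

lemma nonneg_affine_zero_at_rel_interior:
  fixes \<phi> :: "'a::euclidean_space \<Rightarrow> real"
  assumes C: "convex C" and z: "z \<in> rel_interior C"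
    and aff: "\<And>x y t. \<phi> ((1 - t) *\<^sub>R x + t *\<^sub>R y) = (1 - t) * \<phi> x + t * \<phi> y"
    and nonneg: "\<And>x. x \<in> C \<Longrightarrow> 0 \<le> \<phi> x" and zero: "\<phi> z = 0" and x: "x \<in> C"
  shows "\<phi> x = 0"
proof -
  from C z x obtain e where e: "e > 1" "(1 - e) *\<^sub>R x + e *\<^sub>R z \<in> C"
    using convex_rel_interior_iff[of C z] by blast
  have "0 \<le> (1 - e) * \<phi> x" using nonneg[OF e(2)] aff zero by simp
  with e(1) have "\<phi> x \<le> 0" by (simp add: zero_le_mult_iff)
  with nonneg[OF x] show ?thesis by simp
qed

text \<open>
  The multiplier is the normal of a hyperplane separating the origin from the set of
  \<open>(r, s, w)\<close> for which some \<open>x\<close> has value below \<open>\<mu> + r\<close>, constraint values at most \<open>s\<close> and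
  equality residual \<open>w\<close>. Choosing the normal in the span of that set makes the separation
  proper, which is what allows a Slater point in the relative interior only.
\<close>

lemma lagrange_multipliers:
  fixes C :: "'a::euclidean_space set" and f :: "'a \<Rightarrow> real" and h :: "'a \<Rightarrow> real^'l"
    and L :: "'a \<Rightarrow> 'b::euclidean_space"
  assumes f: "convex_on C f" and h: "\<And>j. convex_on C (\<lambda>x. h x $ j)" and L: "linear L"
    and z: "z \<in> rel_interior C" "L z = b" "\<And>j. h z $ j < 0"
    and bound: "\<And>x. x \<in> C \<Longrightarrow> L x = b \<Longrightarrow> (\<And>j. h x $ j \<le> 0) \<Longrightarrow> \<mu> \<le> f x"
  obtains u v where "\<And>j. 0 \<le> v $ j" and "\<And>x. x \<in> C \<Longrightarrow> \<mu> \<le> f x + v \<bullet> h x + u \<bullet> (L x - b)"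
proof -
  \<comment> \<open>Strictness in the first component keeps \<open>0\<close> out of
    \<open>M\<close>, because \<open>bound\<close> rules out \<open>f x < \<mu>\<close> at feasible
    points. \<open>M\<close> is closed under increasing \<open>r\<close> and \<open>s\<close>, which
    later forces \<open>\<alpha>\<close> and \<open>v\<close> to be nonnegative.\<close>
  define M where "M = {(r, s, w). \<exists>x\<in>C. f x < \<mu> + r \<and> (\<forall>j. h x $ j \<le> s $ j) \<and> w = L x - b}"
  have C: "convex C" using f convex_on_imp_convex by blast
  have zC: "z \<in> C" using z(1) rel_interior_subset by blast
  have M_I: "(r, s, L x - b) \<in> M" if "x \<in> C" "f x < \<mu> + r" "\<And>j. h x $ j \<le> s $ j" for x r s
    using that by (auto simp: M_def)
  have "convex M"
  proof (rule convexI)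
    fix y y' and p q :: real
    assume y: "y \<in> M" "y' \<in> M" and pq: "0 \<le> p" "0 \<le> q" "p + q = 1"
    obtain r s x where x: "y = (r, s, L x - b)" "x \<in> C" "f x < \<mu> + r" "\<And>j. h x $ j \<le> s $ j"
      using y(1) by (auto simp: M_def)
    obtain r' s' x' where x': "y' = (r', s', L x' - b)" "x' \<in> C" "f x' < \<mu> + r'"
      "\<And>j. h x' $ j \<le> s' $ j"
      using y(2) by (auto simp: M_def)
    have "p *\<^sub>R x + q *\<^sub>R x' \<in> C" using C x x' pq by (simp add: convexD)
    moreover have "f (p *\<^sub>R x + q *\<^sub>R x') < \<mu> + (p * r + q * r')"
    proof -
      have "f (p *\<^sub>R x + q *\<^sub>R x') \<le> p * f x + q * f x'"
        using f x x' pq by (simp add: convex_on_def)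
      also have "\<dots> < p * (\<mu> + r) + q * (\<mu> + r')"
      \<comment> \<open>Strictness has to come from a point with positive weight: from
        \<open>x\<close> in general, from \<open>x'\<close> if \<open>p = 0\<close>.\<close>
      proof (cases "p = 0")
        case True then show ?thesis using pq x' by simp
      next
        case False
        then have "p * f x < p * (\<mu> + r)" using pq x by simp
        moreover have "q * f x' \<le> q * (\<mu> + r')" using pq x' by (simp add: mult_left_mono)
        ultimately show ?thesis by linarith
      qed
      also have "\<dots> = (p + q) * \<mu> + (p * r + q * r')" by (simp add: algebra_simps)
      finally show ?thesis using pq by simp
    qed
    moreover have "h (p *\<^sub>R x + q *\<^sub>R x') $ j \<le> (p *\<^sub>R s + q *\<^sub>R s') $ j" for j
    proof -
      have "h (p *\<^sub>R x + q *\<^sub>R x') $ j \<le> p * h x $ j + q * h x' $ j"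
        using h[of j] x x' pq by (simp add: convex_on_def)
      also have "\<dots> \<le> p * s $ j + q * s' $ j"
        using x x' pq by (intro add_mono mult_left_mono) auto
      finally show ?thesis by simp
    qed
    ultimately have "(p * r + q * r', p *\<^sub>R s + q *\<^sub>R s', L (p *\<^sub>R x + q *\<^sub>R x') - b) \<in> M"
      by (rule M_I)
    moreover have "L (p *\<^sub>R x + q *\<^sub>R x') - b = p *\<^sub>R (L x - b) + q *\<^sub>R (L x' - b)"
    proof -
      have "b = p *\<^sub>R b + q *\<^sub>R b" using pq(3) by (metis scaleR_left_distrib scaleR_one)
      then show ?thesis
        by (simp add: linear_add[OF L] linear_scale[OF L] algebra_simps)
    qed
    ultimately show "p *\<^sub>R y + q *\<^sub>R y' \<in> M" by (simp add: x(1) x'(1))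
  qed
  moreover have "M \<noteq> {}" using M_I[OF zC, of "f z - \<mu> + 1" "h z"] by auto
  moreover have "0 \<notin> M"
  proof
    assume "0 \<in> M"
    then obtain x where "x \<in> C" "f x < \<mu>" "\<And>j. h x $ j \<le> 0" "L x = b"
      by (auto simp: M_def zero_prod_def)
    with bound[of x] show False by auto
  qed
  ultimately obtain a where a: "a \<in> span M" "a \<noteq> 0" "\<And>y. y \<in> M \<Longrightarrow> 0 \<le> a \<bullet> y"
    using separating_hyperplane_set_0_inspan[of M] by blast
  obtain \<alpha> v u where avu: "a = (\<alpha>, v, u)" by (metis prod_cases3)
  have sep: "0 \<le> \<alpha> * r + v \<bullet> s + u \<bullet> (L x - b)"
    if "x \<in> C" "f x < \<mu> + r" "\<And>j. h x $ j \<le> s $ j" for x r s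
    using a(3)[OF M_I[OF that]] by (simp add: avu)
  have \<alpha>0: "0 \<le> \<alpha>"
  proof (rule slope_nonneg)
    fix t :: real assume "t > 0"
    with sep[OF zC, of "f z - \<mu> + t" "h z"]
    show "0 \<le> \<alpha> * t + (\<alpha> * (f z - \<mu>) + v \<bullet> h z + u \<bullet> (L z - b))" by (simp add: algebra_simps)
  qed
  have v0: "0 \<le> v $ j" for j
  proof (rule slope_nonneg)
    fix t :: real assume "t > 0"
    then have "h z $ i \<le> (h z + t *\<^sub>R axis j 1) $ i" for i by (simp add: axis_def)
    with sep[OF zC, of "f z - \<mu> + 1" "h z + t *\<^sub>R axis j 1"]
    show "0 \<le> v $ j * t + (\<alpha> * (f z - \<mu> + 1) + v \<bullet> h z + u \<bullet> (L z - b))"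
      by (simp add: algebra_simps inner_axis)
  qed
  \<comment> \<open>If \<open>\<alpha> = 0\<close>, separation at \<open>z\<close> gives
    \<open>0 \<le> v \<bullet> h z\<close>, a sum of nonpositive terms, so \<open>v = 0\<close> by
    strictness of the Slater inequalities. Then \<open>u \<bullet> (L x - b)\<close> is nonnegative
    on \<open>C\<close> and zero at \<open>z\<close>, hence zero on \<open>C\<close>. So
    \<open>a\<close> is orthogonal to \<open>M\<close> while lying in its span, which contradicts
    \<open>a \<noteq> 0\<close>.\<close>
  have "\<alpha> \<noteq> 0"
  proof
    assume \<alpha>: "\<alpha> = 0"
    have vj: "v $ j = 0" for j
    proof -
      have "0 \<le> v \<bullet> h z" using sep[OF zC, of "f z - \<mu> + 1" "h z"] \<alpha> z(2) by simp
      moreover have le: "v $ i * h z $ i \<le> 0" for i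
        using v0[of i] z(3)[of i] by (simp add: mult_le_0_iff)
      ultimately have "(\<Sum>i\<in>UNIV. - (v $ i * h z $ i)) \<le> 0"
        by (simp add: inner_vec_def sum_negf)
      moreover have "- (v $ j * h z $ j) \<le> (\<Sum>i\<in>UNIV. - (v $ i * h z $ i))"
        using le by (intro member_le_sum) auto
      ultimately have "v $ j * h z $ j = 0" using le[of j] by linarith
      then show ?thesis using z(3)[of j] by simp
    qed
    then have v: "v = 0" by (simp add: vec_eq_iff)
    have "u \<bullet> (L x - b) = 0" if "x \<in> C" for x
    proof (rule nonneg_affine_zero_at_rel_interior[OF C z(1) _ _ _ that, of "\<lambda>x. u \<bullet> (L x - b)"])
      show "u \<bullet> (L ((1 - t) *\<^sub>R x + t *\<^sub>R y) - b) = (1 - t) * (u \<bullet> (L x - b)) + t * (u \<bullet> (L y - b))"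
        for x y t by (simp add: linear_add[OF L] linear_diff[OF L] linear_scale[OF L] inner_simps algebra_simps)
      show "0 \<le> u \<bullet> (L x - b)" if "x \<in> C" for x
        using sep[OF that, of "f x - \<mu> + 1" "h x"] \<alpha> v by simp
    qed (simp add: z(2))
    then have "y \<in> M \<Longrightarrow> a \<bullet> y = 0" for y
      by (auto simp: M_def avu \<alpha> v)
    then have "a \<bullet> a = 0"
      using a(1) orthogonal_to_span[of a M a] by (auto simp: orthogonal_def)
    with a(2) show False by simp
  qed
  with \<alpha>0 have \<alpha>: "\<alpha> > 0" by simp
  show thesis
  proof (rule that[of "v /\<^sub>R \<alpha>" "u /\<^sub>R \<alpha>"])
    show "0 \<le> (v /\<^sub>R \<alpha>) $ j" for j using v0 \<alpha> by simp
    show "\<mu> \<le> f x + (v /\<^sub>R \<alpha>) \<bullet> h x + (u /\<^sub>R \<alpha>) \<bullet> (L x - b)" if "x \<in> C" for x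
    \<comment> \<open>The strict inequality in \<open>M\<close> excludes
      \<open>r = f x - \<mu>\<close> itself, so this value is approached from above.\<close>
    proof (rule field_le_epsilon)
      fix e :: real assume "e > 0"
      with sep[OF that, of "f x - \<mu> + e" "h x"]
      have "0 \<le> (\<alpha> * (f x - \<mu> + e) + v \<bullet> h x + u \<bullet> (L x - b)) / \<alpha>" using \<alpha> by simp
      also have "\<dots> = f x - \<mu> + e + (v /\<^sub>R \<alpha>) \<bullet> h x + (u /\<^sub>R \<alpha>) \<bullet> (L x - b)"
        using \<alpha> by (simp add: field_simps)
      finally show "\<mu> \<le> f x + (v /\<^sub>R \<alpha>) \<bullet> h x + (u /\<^sub>R \<alpha>) \<bullet> (L x - b) + e" by simp
    qed
  qed
qed

section \<open>Subvectors and coordinate subspaces\<close>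

lemma subvec_add: "subvec J (x + y) = subvec J x + subvec J y"
  by (simp add: subvec_def vec_eq_iff)

lemma subvec_scaleR: "subvec J (t *\<^sub>R x) = t *\<^sub>R subvec J x"
  by (simp add: subvec_def vec_eq_iff)

lemma subvec_zero [simp]: "subvec J 0 = 0"
  by (simp add: subvec_def vec_eq_iff)

lemma subvec_in_coord_space: "subvec J x \<in> coord_space J"
  by (simp add: subvec_def coord_space_def)

lemma subvec_coord_space:
  assumes "disjoint_family I" "x \<in> coord_space (I i)"
  shows "subvec (I j) x = (if j = i then x else 0)"
  using assms by (auto simp: subvec_def coord_space_def vec_eq_iff disjoint_family_on_def)

lemma inner_subvec: "x \<in> coord_space J \<Longrightarrow> x \<bullet> subvec J y = x \<bullet> y"
  by (auto simp: coord_space_def subvec_def inner_vec_def intro!: sum.cong)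

lemma inner_eq_sum_subvec:
  fixes I :: "'m::finite \<Rightarrow> 'n::finite set" and x y :: "real^'n"
  assumes "disjoint_family I" "(\<Union>i. I i) = UNIV"
  shows "x \<bullet> y = (\<Sum>i\<in>UNIV. subvec (I i) x \<bullet> subvec (I i) y)"
proof -
  have "x \<bullet> y = (\<Sum>j\<in>(\<Union>i. I i). x $ j * y $ j)"
    by (simp add: assms(2) inner_vec_def)
  also have "\<dots> = (\<Sum>i\<in>UNIV. \<Sum>j\<in>I i. x $ j * y $ j)"
    using assms(1) by (intro sum.UNION_disjoint) (auto simp: disjoint_family_on_def)
  also have "\<dots> = (\<Sum>i\<in>UNIV. subvec (I i) x \<bullet> subvec (I i) y)"
    by (simp add: inner_vec_def subvec_def if_distrib[of "\<lambda>a. a * _"] sum.If_cases cong: if_cong)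
  finally show ?thesis .
qed

section \<open>Vector gauges and their polars\<close>

context
  fixes I :: "'m::finite \<Rightarrow> 'n::finite set" and g :: "'m \<Rightarrow> real^'n \<Rightarrow> ereal"
  assumes gauge: "\<And>i. gauge_fun_on (coord_space (I i)) (g i)"
begin

lemma gauge_nonneg: "z \<in> coord_space (I i) \<Longrightarrow> 0 \<le> g i z"
  using gauge[of i] by (simp add: gauge_fun_on_def)

lemma gauge_scaleR: "z \<in> coord_space (I i) \<Longrightarrow> 0 < t \<Longrightarrow> g i (t *\<^sub>R z) = ereal t * g i z"
  using gauge[of i] by (simp add: gauge_fun_on_def)

lemma gauge_zero: "g i 0 = 0"
  using gauge[of i] by (simp add: gauge_fun_on_def)

lemma vgauge_eq_real:
  assumes "x \<in> vgauge_dom I g"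
  shows "g i (subvec (I i) x) = ereal (vgauge_real I g x $ i)"
proof -
  have "0 \<le> g i (subvec (I i) x)" "g i (subvec (I i) x) < \<infinity>"
    using assms gauge_nonneg[OF subvec_in_coord_space] by (simp_all add: vgauge_dom_def vgauge_def)
  then show ?thesis by (auto simp: vgauge_real_def vgauge_def ereal_real)
qed

lemma vgauge_real_nonneg: "x \<in> vgauge_dom I g \<Longrightarrow> 0 \<le> vgauge_real I g x $ i"
  using gauge_nonneg[OF subvec_in_coord_space, of i x] by (simp add: vgauge_eq_real)

lemma zero_in_vgauge_dom: "0 \<in> vgauge_dom I g"
  by (simp add: vgauge_dom_def vgauge_def gauge_zero)

lemma vgauge_real_zero: "vgauge_real I g 0 = 0"
  by (simp add: vgauge_real_def vgauge_def gauge_zero vec_eq_iff)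

text \<open>Passage from extended to real values: a finite bound on every block yields membership in
  the domain together with the real inequality. Scaling, convexity and the test vectors for the
  polar all go through it.\<close>

lemma vgauge_domI:
  assumes "\<And>i. g i (subvec (I i) x) \<le> ereal (r $ i)"
  shows "x \<in> vgauge_dom I g" and "vgauge_real I g x $ i \<le> r $ i"
proof -
  have "g i (subvec (I i) x) < \<infinity>" for i
    using assms[of i] by (rule order_le_less_trans) simp
  then show dom: "x \<in> vgauge_dom I g"
    by (simp add: vgauge_dom_def vgauge_def)
  show "vgauge_real I g x $ i \<le> r $ i"
    using assms[of i] by (simp add: vgauge_eq_real[OF dom])
qed

lemma vgauge_dom_scaleR:
  assumes "x \<in> vgauge_dom I g" "0 < t"
  shows "t *\<^sub>R x \<in> vgauge_dom I g" and "vgauge_real I g (t *\<^sub>R x) = t *\<^sub>R vgauge_real I g x"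
proof -
  have eq: "g i (subvec (I i) (t *\<^sub>R x)) = ereal ((t *\<^sub>R vgauge_real I g x) $ i)" for i
    using assms by (simp add: subvec_scaleR gauge_scaleR[OF subvec_in_coord_space] vgauge_eq_real)
  then show dom: "t *\<^sub>R x \<in> vgauge_dom I g"
    by (intro vgauge_domI(1)[of _ "t *\<^sub>R vgauge_real I g x"]) simp
  show "vgauge_real I g (t *\<^sub>R x) = t *\<^sub>R vgauge_real I g x"
    using eq vgauge_eq_real[OF dom] by (simp add: vec_eq_iff)
qed

lemma vgauge_convex_bound:
  assumes "x \<in> vgauge_dom I g" "y \<in> vgauge_dom I g" "0 < t" "t < 1"
  shows "g i (subvec (I i) ((1 - t) *\<^sub>R x + t *\<^sub>R y))
      \<le> ereal (((1 - t) *\<^sub>R vgauge_real I g x + t *\<^sub>R vgauge_real I g y) $ i)"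
proof -
  have "g i ((1 - t) *\<^sub>R subvec (I i) x + t *\<^sub>R subvec (I i) y)
      \<le> ereal (1 - t) * g i (subvec (I i) x) + ereal t * g i (subvec (I i) y)"
    using gauge[of i] subvec_in_coord_space assms(3,4) unfolding gauge_fun_on_def by blast
  with assms(1,2) show ?thesis
    by (simp add: subvec_add subvec_scaleR vgauge_eq_real)
qed

lemma convex_vgauge_dom: "convex (vgauge_dom I g)"
  unfolding convex_alt
proof (intro ballI allI impI)
  fix x y t assume xy: "x \<in> vgauge_dom I g" "y \<in> vgauge_dom I g" and t: "0 \<le> t \<and> t \<le> (1::real)"
  \<comment> \<open>The endpoints are separate because \<open>gauge_fun_on\<close> gives convexity
    only for weights strictly between 0 and 1.\<close>
  consider "t = 0" | "t = 1" | "0 < t" "t < 1" using t by linarith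
  then show "(1 - t) *\<^sub>R x + t *\<^sub>R y \<in> vgauge_dom I g"
    by cases (use xy vgauge_domI(1)[OF vgauge_convex_bound] in auto)
qed

text \<open>Here the signs of \<open>d\<close> and \<open>K\<close> enter: nonnegative weights
  preserve the componentwise convexity of the gauge. The form covers both the objective and each
  constraint row, with \<open>s\<close> as the constant \<open>- p $ j\<close>.\<close>

lemma convex_on_linear_plus_vgauge:
  assumes "\<And>i. 0 \<le> e $ i"
  shows "convex_on (vgauge_dom I g) (\<lambda>x. q \<bullet> x + e \<bullet> vgauge_real I g x + s)"
proof (rule convex_onI[OF _ convex_vgauge_dom])
  fix t :: real and x y
  assume t: "0 < t" "t < 1" and xy: "x \<in> vgauge_dom I g" "y \<in> vgauge_dom I g"
  have "e \<bullet> vgauge_real I g ((1 - t) *\<^sub>R x + t *\<^sub>R y)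
      \<le> e \<bullet> ((1 - t) *\<^sub>R vgauge_real I g x + t *\<^sub>R vgauge_real I g y)"
    unfolding inner_vec_def inner_real_def
    by (intro sum_mono mult_left_mono vgauge_domI(2)[OF vgauge_convex_bound] xy t assms)
  then show "q \<bullet> ((1 - t) *\<^sub>R x + t *\<^sub>R y) + e \<bullet> vgauge_real I g ((1 - t) *\<^sub>R x + t *\<^sub>R y) + s
      \<le> (1 - t) * (q \<bullet> x + e \<bullet> vgauge_real I g x + s) + t * (q \<bullet> y + e \<bullet> vgauge_real I g y + s)"
    by (simp add: inner_simps algebra_simps)
qed

text \<open>Forwards, each block is scaled into the unit ball of its gauge and the resulting bounds
  are summed over the partition. Backwards, the bound is tested on unit-ball vectors supported in a
  single block.\<close>

lemma vgauge_polar_le_iff: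
  assumes disj: "disjoint_family I" and cover: "(\<Union>i. I i) = UNIV" and e: "\<And>i. 0 \<le> e $ i"
  shows "(\<forall>i. vgauge_polar I g w $ i \<le> ereal (e $ i)) \<longleftrightarrow>
    (\<forall>x\<in>vgauge_dom I g. w \<bullet> x \<le> e \<bullet> vgauge_real I g x)"
proof (intro iffI allI ballI)
  fix x assume pol: "\<forall>i. vgauge_polar I g w $ i \<le> ereal (e $ i)" and x: "x \<in> vgauge_dom I g"
  have le: "subvec (I i) x \<bullet> subvec (I i) w \<le> vgauge_real I g x $ i * e $ i" for i
  proof -
    define z y \<gamma> where "z = subvec (I i) x" and "y = subvec (I i) w" and "\<gamma> = vgauge_real I g x $ i"
    have \<gamma>: "0 \<le> \<gamma>" "g i z = ereal \<gamma>"
      using vgauge_real_nonneg[OF x] vgauge_eq_real[OF x] by (simp_all add: \<gamma>_def z_def)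
    have "0 \<le> \<gamma> * e $ i - z \<bullet> y"
    proof (rule slope_nonneg)
      fix t :: real assume t: "t > 0"
      \<comment> \<open>Scaling by \<open>1 / \<gamma>\<close> would fail for
        \<open>\<gamma> = 0\<close>. This \<open>s\<close> satisfies
        \<open>s * \<gamma> \<le> 1\<close> for every \<open>t\<close>, and clearing its denominator
        gives an inequality affine in \<open>t\<close> whose slope is the desired
        difference.\<close>
      define s where "s = t / (t * \<gamma> + 1)"
      have pos: "t * \<gamma> + 1 > 0" using t \<gamma> by (simp add: add_nonneg_pos)
      then have s: "s > 0" "s * \<gamma> \<le> 1" using t by (simp_all add: s_def)
      have "s *\<^sub>R z \<in> coord_space (I i)"
        using subvec_in_coord_space[of "I i" "s *\<^sub>R x"] by (simp add: z_def subvec_scaleR)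
      moreover have "g i (s *\<^sub>R z) \<le> 1"
        using s \<gamma> gauge_scaleR[OF subvec_in_coord_space, of s i x]
        by (simp add: z_def one_ereal_def)
      ultimately have "ereal ((s *\<^sub>R z) \<bullet> y) \<le> polar_on (coord_space (I i)) (g i) y"
        unfolding polar_on_def by (intro SUP_upper) simp
      also have "\<dots> \<le> ereal (e $ i)" using pol by (simp add: vgauge_polar_def y_def)
      finally have "s * (z \<bullet> y) \<le> e $ i" by simp
      then have "t * (z \<bullet> y) \<le> e $ i * (t * \<gamma> + 1)" using pos by (simp add: s_def pos_divide_le_eq)
      then show "0 \<le> (\<gamma> * e $ i - z \<bullet> y) * t + e $ i" by (simp add: algebra_simps)
    qed
    then show ?thesis by (simp add: z_def y_def \<gamma>_def)
  qed
  have "w \<bullet> x = (\<Sum>i\<in>UNIV. subvec (I i) x \<bullet> subvec (I i) w)"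
    by (subst inner_commute) (rule inner_eq_sum_subvec[OF disj cover])
  also have "\<dots> \<le> (\<Sum>i\<in>UNIV. vgauge_real I g x $ i * e $ i)"
    by (intro sum_mono le)
  finally show "w \<bullet> x \<le> e \<bullet> vgauge_real I g x"
    by (simp add: inner_vec_def mult.commute)
next
  fix i assume bound: "\<forall>x\<in>vgauge_dom I g. w \<bullet> x \<le> e \<bullet> vgauge_real I g x"
  have "z \<bullet> subvec (I i) w \<le> e $ i" if z: "z \<in> coord_space (I i)" "g i z \<le> 1" for z
  proof -
    \<comment> \<open>The other subvectors of \<open>z\<close> vanish and have gauge 0, so the unit
      vector \<open>axis i 1\<close> bounds all blocks at once.\<close>
    have le: "g j (subvec (I j) z) \<le> ereal (axis i 1 $ j)" for j
      using z by (simp add: subvec_coord_space[OF disj] gauge_zero axis_def one_ereal_def zero_ereal_def)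
    have "z \<bullet> subvec (I i) w = w \<bullet> z"
      using inner_subvec[OF z(1)] by (simp add: inner_commute)
    also have "\<dots> \<le> e \<bullet> vgauge_real I g z"
      using bound vgauge_domI(1)[OF le] by blast
    also have "\<dots> \<le> e \<bullet> axis i 1"
      unfolding inner_vec_def inner_real_def
      by (intro sum_mono mult_left_mono vgauge_domI(2)[OF le] e)
    finally show ?thesis by (simp add: inner_axis)
  qed
  then show "vgauge_polar I g w $ i \<le> ereal (e $ i)"
    by (auto simp: vgauge_polar_def polar_on_def intro!: SUP_least)
qed

text \<open>Once \<open>transpose K *v v\<close> is moved to the right, the bound
  \<open>d + transpose K *v v\<close> is nonnegative for \<open>v \<ge> 0\<close>, so the polar
  characterization applies.\<close>

lemma dual_feasible_iff:
  assumes "disjoint_family I" "(\<Union>i. I i) = UNIV" "\<And>i. 0 \<le> d $ i" "\<And>j i. 0 \<le> K $ j $ i"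
  shows "dual_feasible c d A H K I g (u, v) \<longleftrightarrow> 0 \<le> v \<and>
    (\<forall>x\<in>vgauge_dom I g. (transpose A *v u - transpose H *v v - c) \<bullet> x
       \<le> (d + transpose K *v v) \<bullet> vgauge_real I g x)"
proof (cases "0 \<le> v")
  case True
  have e: "0 \<le> (d + transpose K *v v) $ i" for i
    using assms(3,4) True
    by (auto simp: matrix_vector_mult_def transpose_def less_eq_vec_def intro!: add_nonneg_nonneg sum_nonneg)
  have minus_le: "a - ereal k \<le> ereal r \<longleftrightarrow> a \<le> ereal (r + k)" for a :: ereal and k r
    by (cases a) auto
  then show ?thesis
    using True vgauge_polar_le_iff[OF assms(1,2) e] by (simp add: dual_feasible_def minus_le)
qed (simp add: dual_feasible_def)

end

section \<open>Duality for the gauge problem\<close>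

text \<open>Splits the Lagrangian into a part linear in \<open>(x, G)\<close>, whose sign on the
  domain encodes dual feasibility, and a constant, the dual objective. It serves both directions of
  the duality.\<close>

lemma lagrangian_rearrange:
  fixes A :: "real^'n^'k" and H :: "real^'n^'l" and K :: "real^'m^'l"
  shows "c \<bullet> x + d \<bullet> G + v \<bullet> (H *v x + K *v G - p) - u \<bullet> (A *v x - b) =
    (d + transpose K *v v) \<bullet> G - (transpose A *v u - transpose H *v v - c) \<bullet> x
      + (b \<bullet> u - p \<bullet> v)"
  by (simp add: inner_add_left inner_diff_left inner_add_right inner_diff_right
      dot_lmul_matrix inner_commute[of p] inner_commute[of b])

theorem theorem3:
  fixes c :: "real^'n" and d :: "real^'m" and b :: "real^'k" and p :: "real^'l"
    and A :: "real^'n^'k" and H :: "real^'n^'l" and K :: "real^'m^'l"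
    and I :: "'m::finite \<Rightarrow> 'n::finite set" and g :: "'m::finite \<Rightarrow> real^'n \<Rightarrow> ereal"
    and xstar :: "real^'n"
  assumes "disjoint_family I" and "(\<Union>i. I i) = UNIV"
    and "\<And>i. gauge_fun_on (coord_space (I i)) (g i)"
    and "\<And>i. 0 \<le> d $ i" and "\<And>j i. 0 \<le> K $ j $ i"
    and "slater A b H K p I g"
    and "is_arg_min (primal_obj c d I g) (primal_feasible A b H K p I g) xstar"
  shows "\<exists>ustar vstar.
    is_arg_max (dual_obj b p) (dual_feasible c d A H K I g) (ustar, vstar) \<and>
    c \<bullet> xstar + d \<bullet> vgauge_real I g xstar = b \<bullet> ustar - p \<bullet> vstar"
proof -
  note gauge = assms(3)
  note dual_iff = dual_feasible_iff[OF gauge assms(1,2,4,5)]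
  let ?D = "vgauge_dom I g" and ?G = "vgauge_real I g"
  let ?h = "\<lambda>x. H *v x + K *v ?G x - p"
  let ?e = "\<lambda>v. d + transpose K *v v" and ?w = "\<lambda>u v. transpose A *v u - transpose H *v v - c"
  define \<mu> where "\<mu> = primal_obj c d I g xstar"
  have feas: "primal_feasible A b H K p I g xstar"
    and opt: "\<And>x. primal_feasible A b H K p I g x \<Longrightarrow> \<mu> \<le> primal_obj c d I g x"
    using assms(7) by (auto simp: is_arg_min_def \<mu>_def not_less)
  obtain z where z: "z \<in> rel_interior ?D" "A *v z = b" "\<And>j. ?h z $ j < 0"
    using assms(6) by (auto simp: slater_def)

  obtain u v where v: "\<And>j. 0 \<le> v $ j"
    and "\<And>x. x \<in> ?D \<Longrightarrow> \<mu> \<le> primal_obj c d I g x + v \<bullet> ?h x + u \<bullet> (A *v x - b)"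
  proof (rule lagrange_multipliers[of ?D "primal_obj c d I g" ?h "(*v) A" z b \<mu>])
    show "convex_on ?D (primal_obj c d I g)"
      using convex_on_linear_plus_vgauge[OF gauge assms(4), where q = c and s = 0]
      by (simp add: primal_obj_def[abs_def])
    show "convex_on ?D (\<lambda>x. ?h x $ j)" for j
      using convex_on_linear_plus_vgauge[OF gauge, where e = "K $ j" and q = "H $ j" and s = "- p $ j"] assms(5)
      by (simp add: matrix_vector_mul_component)
    show "\<mu> \<le> primal_obj c d I g x" if "x \<in> ?D" "A *v x = b" "\<And>j. ?h x $ j \<le> 0" for x
      using that by (intro opt) (simp add: primal_feasible_def less_eq_vec_def)
  qed (use z in auto)
  \<comment> \<open>The multiplier lemma adds the equality term while the dual convention subtracts
    it, so the dual variable is \<open>- u\<close>.\<close>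
  then have "\<mu> \<le> c \<bullet> x + d \<bullet> ?G x + v \<bullet> ?h x - (- u) \<bullet> (A *v x - b)" if "x \<in> ?D" for x
    using that by (simp add: primal_obj_def)
  then have lag: "\<mu> \<le> ?e v \<bullet> ?G x - ?w (- u) v \<bullet> x + (b \<bullet> (- u) - p \<bullet> v)" if "x \<in> ?D" for x
    using that unfolding lagrangian_rearrange by blast

  have "0 \<le> ?e v \<bullet> ?G x - ?w (- u) v \<bullet> x" if x: "x \<in> ?D" for x
  proof (rule slope_nonneg)
    fix t :: real assume "t > 0"
    with lag[OF vgauge_dom_scaleR(1)[OF gauge x]] vgauge_dom_scaleR(2)[OF gauge x]
    show "0 \<le> (?e v \<bullet> ?G x - ?w (- u) v \<bullet> x) * t + (b \<bullet> (- u) - p \<bullet> v - \<mu>)"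
      by (fastforce simp: algebra_simps)
  qed
  then have dual: "dual_feasible c d A H K I g (- u, v)"
    using v by (simp add: dual_iff less_eq_vec_def)
  have ge: "\<mu> \<le> dual_obj b p (- u, v)"
    using lag[OF zero_in_vgauge_dom[OF gauge]]
    by (simp add: vgauge_real_zero[OF gauge] dual_obj_def)

  \<comment> \<open>Comparison at \<open>xstar\<close> suffices: feasibility makes the Lagrangian
    there at most \<open>\<mu>\<close>, and dual feasibility makes its linear part nonnegative,
    leaving the dual objective below \<open>\<mu>\<close>.\<close>
  have weak: "dual_obj b p (u', v') \<le> \<mu>" if "dual_feasible c d A H K I g (u', v')" for u' v'
  proof -
    have x: "A *v xstar = b" "\<And>j. ?h xstar $ j \<le> 0" "xstar \<in> ?D"
      using feas by (auto simp: primal_feasible_def less_eq_vec_def)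
    have d': "\<And>j. 0 \<le> v' $ j" "?w u' v' \<bullet> xstar \<le> ?e v' \<bullet> ?G xstar"
      using that x(3) by (auto simp: dual_iff less_eq_vec_def)
    have "v' \<bullet> ?h xstar \<le> 0"
      unfolding inner_vec_def inner_real_def using x(2) d'(1) by (intro sum_nonpos mult_nonneg_nonpos)
    with d'(2) show ?thesis
      using lagrangian_rearrange[of c xstar d "?G xstar" v' H K p u' A b] x(1)
      by (simp add: dual_obj_def \<mu>_def primal_obj_def)
  qed
  have "dual_obj b p (- u, v) = \<mu>" using ge weak[OF dual] by simp
  moreover from this have "is_arg_max (dual_obj b p) (dual_feasible c d A H K I g) (- u, v)"
    using dual weak by (auto simp: is_arg_max_def not_less)
  ultimately show ?thesis
    by (intro exI[of _ "- u"] exI[of _ v]) (simp add: dual_obj_def \<mu>_def primal_obj_def)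
qed

end
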